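(* Given $\gamma\in\mathbb{R}^+$, suppose that the cost-to-go functions $V_j$, $j=0,\dots,N_f$, of the variable $x\in\mathbb{R}^M$ satisfy $$V_{N_f}(x)=\frac{p_d}{30}\gamma,\qquad V_{j-1}(x)=\min_{u\in W_{\gamma,j-1}(x)}\Big(p_{j-1}\,g(j-1,u,x_1)\,\Delta t+V_j(f(x,u))\Big),\quad j=1,\dots,N_f,$$ where $x_1$ is the first component of $x$. Then $V_0(T^0)=J^*$, where $$\begin{aligned} J^*=J^*(p)=\min_{u_k\in\mathbb{R},\,T^k\in\mathbb{R}^M}\ & J_e(\mathbf u,T_1,p_{\mathrm{on}},p_{\mathrm{off}})+\frac{p_d}{30}\gamma\\ \text{subject to}\quad & g(k,u_k,T_1^k)\le\gamma && \text{for }k\in S_{\mathrm{on}},\\ & T^{k+1}=f(T^k,u_k) && \text{for }k\in S_{\mathrm{on}}\cup S_{\mathrm{off}},\\ & T_{\min}\le u_k\le T_{\max} && \text{for }k\in S_{\mathrm{on}}\cup S_{\mathrm{off}},\\ & T^0=[T_{\mathrm{init}}(\Delta x),\dots,T_{\mathrm{init}}(M\,\Delta x)]^T. \end{aligned}$$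
   Context: The setting is discretized optimal thermostat programming over one day. $N_f$ and $M$ are positive integers, $\Delta t>0$ is the time step (in hours), and $N_f\,\Delta t=24$. The on-peak period starts at time $t_{\mathrm{on}}$ and ends at time $t_{\mathrm{off}}>t_{\mathrm{on}}$ within the day $[0,24]$. $p=[p_{\mathrm{on}},p_{\mathrm{off}},p_d]$ is the given vector of on-peak, off-peak and demand prices. $T_{\min},T_{\max}\in\mathbb{R}$ are the acceptable lower and upper bounds on the interior temperature, and $T_{\mathrm{init}}$ is the given real-valued initial temperature distribution in the wall. **Time steps.** $S_{\mathrm{on}}$ is the set of $k\in\{0,\dots,N_f-1\}$ with $k\,\Delta t\in[t_{\mathrm{on}},t_{\mathrm{off}}]$, and $S_{\mathrm{off}}$ is the set of all other $k\in\{0,\dots,N_f-1\}$. The dilated prices are $p_j:=p_{\mathrm{off}}$ if $j\in S_{\mathrm{off}}$ and $p_j:=p_{\mathrm{on}}$ otherwise. **Dynamics.** $f(T,u):=(I+A\,\Delta t)T+B\,\Delta t\,u$ for $T\in\mathbb{R}^M$, $u\in\mathbb{R}$, where $A=\frac{\alpha}{\Delta x^2}\tilde A$ with $\tilde A\in\mathbb{R}^{M\times M}$ the tridiagonal matrix having $-2$ on the diagonal and $1$ on the sub- and superdiagonals, and $B=\frac{\alpha}{\Delta x^2}[1,0,\dots,0,1]^T\in\mathbb{R}^M$. Here $\alpha$ is the thermal diffusivity coefficient and $\Delta x=L_{in}/(M+1)$, where $L_{in}$ is the nominal width of the interior wall. **Power consumption.** $g(k,u,\theta):=\frac{T_e^k-u}{R_e}+2\,C_{in}\frac{\theta-u}{\Delta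 x}$, where $R_e$ is the thermal resistance of the exterior walls, $C_{in}$ is the thermal capacitance of the interior walls, and $T_e^k$ is the given external temperature at time step $k$. **Energy cost.** For $\mathbf u=[u_0,\dots,u_{N_f-1}]\in\mathbb{R}^{N_f}$ and $T_1^k$ the first component of $T^k$, $$J_e(\mathbf u,T_1,p_{\mathrm{on}},p_{\mathrm{off}}):=\Big(p_{\mathrm{off}}\sum_{k\in S_{\mathrm{off}}}g(k,u_k,T_1^k)+p_{\mathrm{on}}\sum_{k\in S_{\mathrm{on}}}g(k,u_k,T_1^k)\Big)\Delta t.$$ **Allowable inputs.** $W_{\gamma,j}(x):=\{u\in\mathbb{R}:T_{\min}\le u\le T_{\max},\ g(j,u,x_1)\le\gamma\}$ if $j\in S_{\mathrm{on}}$, and $W_{\gamma,j}(x):=\{u\in\mathbb{R}:T_{\min}\le u\le T_{\max}\}$ if $j\in S_{\mathrm{off}}$. *)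

theory Defs
  imports "HOL-Library.Extended_Real" "Jordan_Normal_Form.Matrix"
begin

record thermostat =
  num_steps :: nat             \<comment> \<open>\<open>N_f\<close>\<close>
  num_nodes :: nat             \<comment> \<open>\<open>M\<close>, number of interior wall nodes\<close>
  time_step :: real            \<comment> \<open>in hours\<close>
  on_peak_start :: real
  on_peak_end :: real
  diffusivity :: real
  wall_width :: real           \<comment> \<open>\<open>L_in\<close>, interior wall\<close>
  wall_resistance :: real      \<comment> \<open>\<open>R_e\<close>, exterior walls\<close>
  wall_capacitance :: real     \<comment> \<open>\<open>C_in\<close>, interior walls\<close>
  external_temp :: "nat \<Rightarrow> real"
  temp_min :: real
  temp_max :: real
  init_temp :: "real \<Rightarrow> real"

definition space_step :: "thermostat \<Rightarrow> real" where
  "space_step P = wall_width P / real (num_nodes P + 1)"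

definition S_on :: "thermostat \<Rightarrow> nat set" where
  "S_on P = {k \<in> {..<num_steps P}. real k * time_step P \<in> {on_peak_start P..on_peak_end P}}"

definition S_off :: "thermostat \<Rightarrow> nat set" where
  "S_off P = {..<num_steps P} - S_on P"

definition dilated_price :: "thermostat \<Rightarrow> real \<Rightarrow> real \<Rightarrow> nat \<Rightarrow> real" where
  "dilated_price P p_on p_off j = (if j \<in> S_off P then p_off else p_on)"

definition A_tilde :: "nat \<Rightarrow> real mat" where
  "A_tilde m = mat m m (\<lambda>(i, j).
     if i = j then - 2 else if i = Suc j \<or> j = Suc i then 1 else 0)"

definition A_mat :: "thermostat \<Rightarrow> real mat" where
  "A_mat P = (diffusivity P / (space_step P)\<^sup>2) \<cdot>\<^sub>m A_tilde (num_nodes P)"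

text \<open>For a single node, the first and last entries of \<open>[1,0,\<dots>,0,1]\<close> coincide and the vector
  is read as \<open>[1]\<close>.\<close>

definition B_vec :: "thermostat \<Rightarrow> real vec" where
  "B_vec P = (diffusivity P / (space_step P)\<^sup>2) \<cdot>\<^sub>v
     vec (num_nodes P) (\<lambda>i. if i = 0 \<or> i = num_nodes P - 1 then 1 else 0)"

definition dynamics :: "thermostat \<Rightarrow> real vec \<Rightarrow> real \<Rightarrow> real vec" where
  "dynamics P T u =
     (1\<^sub>m (num_nodes P) + time_step P \<cdot>\<^sub>m A_mat P) *\<^sub>v T + (time_step P * u) \<cdot>\<^sub>v B_vec P"

definition power_consumption :: "thermostat \<Rightarrow> nat \<Rightarrow> real \<Rightarrow> real \<Rightarrow> real" where
  "power_consumption P k u \<theta> = (external_temp P k - u) / wall_resistance P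
     + 2 * wall_capacitance P * ((\<theta> - u) / space_step P)"

definition energy_cost ::
  "thermostat \<Rightarrow> real vec \<Rightarrow> (nat \<Rightarrow> real) \<Rightarrow> real \<Rightarrow> real \<Rightarrow> real" where
  "energy_cost P u T1 p_on p_off =
     (p_off * (\<Sum>k\<in>S_off P. power_consumption P k (u $ k) (T1 k))
      + p_on * (\<Sum>k\<in>S_on P. power_consumption P k (u $ k) (T1 k))) * time_step P"

text \<open>Vector entries are indexed from 0, so the first component of \<open>x\<close> is \<open>x $ 0\<close>.\<close>

definition allowable_inputs :: "thermostat \<Rightarrow> real \<Rightarrow> nat \<Rightarrow> real vec \<Rightarrow> real set" where
  "allowable_inputs P \<gamma> j x =
     (if j \<in> S_on P
      then {u. temp_min P \<le> u \<and> u \<le> temp_max P \<and> power_consumption P j u (x $ 0) \<le> \<gamma>}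
      else {u. temp_min P \<le> u \<and> u \<le> temp_max P})"

definition initial_state :: "thermostat \<Rightarrow> real vec" where
  "initial_state P = vec (num_nodes P) (\<lambda>i. init_temp P (real (i + 1) * space_step P))"

text \<open>On-peak input sets can be empty (for instance when \<open>x $ 0\<close> is large), so minima are taken
  in the extended reals: the minimum of a nonempty set has to be attained, while the minimum of the
  empty set is \<open>\<infinity>\<close>, which is its infimum.\<close>

definition is_minimum :: "ereal set \<Rightarrow> ereal \<Rightarrow> bool" where
  "is_minimum S m \<longleftrightarrow> m = Inf S \<and> (S \<noteq> {} \<longrightarrow> m \<in> S)"

text \<open>A feasible pair consists of the inputs \<open>u\<^sub>0, \<dots>, u\<^bsub>N-1\<^esub>\<close> and the states \<open>T\<^sup>0, \<dots>, T\<^sup>N\<close>, where \<open>N\<close> is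
  the number of steps; values \<open>T k\<close> for larger \<open>k\<close> are irrelevant.\<close>

definition feasible :: "thermostat \<Rightarrow> real \<Rightarrow> (real vec \<times> (nat \<Rightarrow> real vec)) set" where
  "feasible P \<gamma> = {(u, T).
     u \<in> carrier_vec (num_steps P) \<and>
     (\<forall>k\<le>num_steps P. T k \<in> carrier_vec (num_nodes P)) \<and>
     (\<forall>k\<in>S_on P. power_consumption P k (u $ k) (T k $ 0) \<le> \<gamma>) \<and>
     (\<forall>k\<in>S_on P \<union> S_off P. T (k + 1) = dynamics P (T k) (u $ k)) \<and>
     (\<forall>k\<in>S_on P \<union> S_off P. temp_min P \<le> u $ k \<and> u $ k \<le> temp_max P) \<and>
     T 0 = initial_state P}"

definition total_costs :: "thermostat \<Rightarrow> real \<Rightarrow> real \<Rightarrow> real \<Rightarrow> real \<Rightarrow> ereal set" where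
  "total_costs P \<gamma> p_on p_off p_d =
     {ereal (energy_cost P u (\<lambda>k. T k $ 0) p_on p_off + p_d / 30 * \<gamma>) | u T.
        (u, T) \<in> feasible P \<gamma>}"

definition J_star :: "thermostat \<Rightarrow> real \<Rightarrow> real \<Rightarrow> real \<Rightarrow> real \<Rightarrow> ereal" where
  "J_star P \<gamma> p_on p_off p_d = Inf (total_costs P \<gamma> p_on p_off p_d)"

end

theory Submission
  imports Defs
begin

text \<open>The theorem is Bellman's principle of optimality for a deterministic problem with finitely many
  stages. Two features of this problem make it applicable. The energy cost is a sum over stages,
  because the dilated price selects the coefficient of each stage
  (\<open>energy_cost_eq_sum_stage_costs\<close>). The constraints couple the input and the state of one stage
  only, because the peak bound \<open>\<gamma>\<close> is fixed; so feasibility means that each input is allowable at the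
  current state (\<open>feasible_iff_is_path\<close>).

  For the general problem, the recursion is unrolled forwards along a path. Along any path the
  recursion gives \<open>V\<^sub>k(x\<^sub>k) \<le> c\<^sub>k + V\<^bsub>k+1\<^esub>(x\<^bsub>k+1\<^esub>)\<close>, and telescoping shows that \<open>V\<^sub>0\<close> is at
  most the total cost (\<open>cost_to_go_le\<close>). If \<open>V\<^sub>0\<close> is not \<open>\<infinity>\<close>, then each minimum along the way is
  attained; following minimising inputs turns every inequality into an equality, so \<open>V\<^sub>0\<close> is the cost of
  a path (\<open>cost_to_go_attained\<close>). If \<open>V\<^sub>0\<close> is \<open>\<infinity>\<close>, the first part shows that there are no paths,
  since the cost of a path is a real number, and the infimum of no costs is \<open>\<infinity>\<close> as well.\<close>

section \<open>Minima in the extended reals\<close>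

text \<open>This form avoids a case distinction on emptiness. For \<open>m = \<infinity>\<close> the two readings agree because a
  set with lower bound \<open>\<infinity>\<close> is either empty or \<open>{\<infinity>}\<close>, and its infimum is \<open>\<infinity>\<close> in both cases.\<close>

lemma is_minimum_iff:
  "is_minimum S m \<longleftrightarrow> (\<forall>s\<in>S. m \<le> s) \<and> (m \<noteq> \<infinity> \<longrightarrow> m \<in> S)"
proof
  assume "is_minimum S m"
  then show "(\<forall>s\<in>S. m \<le> s) \<and> (m \<noteq> \<infinity> \<longrightarrow> m \<in> S)"
    by (cases "S = {}") (auto simp: is_minimum_def Inf_lower top_ereal_def)
next
  assume m: "(\<forall>s\<in>S. m \<le> s) \<and> (m \<noteq> \<infinity> \<longrightarrow> m \<in> S)"
  have mem: "m \<in> S" if "S \<noteq> {}"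
    using m that by fastforce
  show "is_minimum S m"
  proof (cases "S = {}")
    case True
    then show ?thesis
      using m by (auto simp: is_minimum_def top_ereal_def)
  next
    case False
    then have "m = Inf S"
      using m mem by (intro antisym Inf_greatest Inf_lower) auto
    then show ?thesis
      using mem by (simp add: is_minimum_def)
  qed
qed

section \<open>The principle of optimality\<close>

text \<open>Only the inputs before stage \<open>N\<close> and the states up to stage \<open>N\<close> are constrained, so a path and
  its cost do not depend on the later values of the two functions.\<close>

definition is_path ::
  "nat \<Rightarrow> (nat \<Rightarrow> 'x \<Rightarrow> 'u set) \<Rightarrow> ('x \<Rightarrow> 'u \<Rightarrow> 'x) \<Rightarrow> 'x \<Rightarrow> (nat \<Rightarrow> 'u) \<Rightarrow> (nat \<Rightarrow> 'x) \<Rightarrow> bool" where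
  "is_path N U F x0 u T \<longleftrightarrow>
     T 0 = x0 \<and> (\<forall>k<N. u k \<in> U k (T k) \<and> T (Suc k) = F (T k) (u k))"

text \<open>The value functions may be infinite, which is how they record that no input sequence meets the
  constraints.\<close>

locale bellman_recursion =
  fixes N :: nat
    and X :: "'x set"
    and U :: "nat \<Rightarrow> 'x \<Rightarrow> 'u set"
    and F :: "'x \<Rightarrow> 'u \<Rightarrow> 'x"
    and c :: "nat \<Rightarrow> 'x \<Rightarrow> 'u \<Rightarrow> real"
    and h :: "'x \<Rightarrow> real"
    and V :: "nat \<Rightarrow> 'x \<Rightarrow> ereal"
  assumes F_closed: "x \<in> X \<Longrightarrow> F x u \<in> X"
    and terminal: "x \<in> X \<Longrightarrow> V N x = ereal (h x)"
    and recursion: "k < N \<Longrightarrow> x \<in> X \<Longrightarrow>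
      is_minimum {ereal (c k x u) + V (Suc k) (F x u) | u. u \<in> U k x} (V k x)"
begin

lemma path_in_states:
  assumes "is_path N U F x0 u T" and "x0 \<in> X" and "k \<le> N"
  shows "T k \<in> X"
  using assms(3) by (induction k) (use assms(1,2) F_closed in \<open>auto simp: is_path_def\<close>)

lemma cost_to_go_le_step:
  assumes "k < N" and "x \<in> X" and "u \<in> U k x"
  shows "V k x \<le> ereal (c k x u) + V (Suc k) (F x u)"
  using recursion[OF assms(1,2)] assms(3) by (auto simp: is_minimum_iff)

lemma minimising_input_exists:
  assumes "k < N" and "x \<in> X" and "V k x \<noteq> \<infinity>"
  shows "\<exists>u\<in>U k x. V k x = ereal (c k x u) + V (Suc k) (F x u)"
  using recursion[OF assms(1,2)] assms(3) by (auto simp: is_minimum_iff)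

text \<open>The first of the two halves: no path costs less than the value function. The partial sums are
  needed for the induction on the stage.\<close>

lemma cost_to_go_le:
  assumes path: "is_path N U F x0 u T" and "x0 \<in> X"
  shows "V 0 x0 \<le> ereal ((\<Sum>k<N. c k (T k) (u k)) + h (T N))"
proof -
  have "V 0 x0 \<le> ereal (\<Sum>k<n. c k (T k) (u k)) + V n (T n)" if "n \<le> N" for n
    using that
  proof (induction n)
    case 0
    then show ?case
      using path by (simp add: is_path_def zero_ereal_def[symmetric])
  next
    case (Suc n)
    have "V n (T n) \<le> ereal (c n (T n) (u n)) + V (Suc n) (T (Suc n))"
      using cost_to_go_le_step[of n "T n" "u n"] path_in_states[OF assms, of n] path Suc.prems
      by (auto simp: is_path_def)
    then have "ereal (\<Sum>k<n. c k (T k) (u k)) + V n (T n)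
        \<le> ereal (\<Sum>k<Suc n. c k (T k) (u k)) + V (Suc n) (T (Suc n))"
      using add_left_mono[of _ _ "ereal (\<Sum>k<n. c k (T k) (u k))"]
      by (simp add: add.assoc flip: plus_ereal.simps(1))
    then show ?case
      using Suc by (meson Suc_leD order_trans)
  qed
  from this[of N] show ?thesis
    using terminal path_in_states[OF assms] by simp
qed

text \<open>The other half. Finiteness of the value is passed on to the next state by a minimising input,
  since the stage cost is real; hence the path of minimising inputs never reaches a state without
  allowable inputs.\<close>

lemma cost_to_go_attained:
  assumes "x0 \<in> X" and "V 0 x0 \<noteq> \<infinity>"
  shows "\<exists>u T. is_path N U F x0 u T \<and>
    V 0 x0 = ereal ((\<Sum>k<N. c k (T k) (u k)) + h (T N))"
proof -
  obtain \<mu> where \<mu>: "\<mu> k x \<in> U k x" "V k x = ereal (c k x (\<mu> k x)) + V (Suc k) (F x (\<mu> k x))"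
    if "k < N" "x \<in> X" "V k x \<noteq> \<infinity>" for k x
    using minimising_input_exists by metis
  define T where "T = rec_nat x0 (\<lambda>k x. F x (\<mu> k x))"
  define u where "u k = \<mu> k (T k)" for k
  have T_0: "T 0 = x0" and T_Suc: "T (Suc k) = F (T k) (u k)" for k
    by (simp_all add: T_def u_def)
  have inv: "T n \<in> X \<and> V n (T n) \<noteq> \<infinity> \<and>
      V 0 x0 = ereal (\<Sum>k<n. c k (T k) (u k)) + V n (T n)" if "n \<le> N" for n
    using that
  proof (induction n)
    case 0
    then show ?case
      using assms by (simp add: T_0 zero_ereal_def[symmetric])
  next
    case (Suc n)
    then have IH: "T n \<in> X" "V n (T n) \<noteq> \<infinity>"
        "V 0 x0 = ereal (\<Sum>k<n. c k (T k) (u k)) + V n (T n)"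
      by auto
    have step: "V n (T n) = ereal (c n (T n) (u n)) + V (Suc n) (T (Suc n))"
      using \<mu>(2)[of n "T n"] IH Suc.prems by (simp add: u_def T_Suc)
    have "T (Suc n) \<in> X"
      using IH F_closed by (simp add: T_Suc)
    moreover have "V (Suc n) (T (Suc n)) \<noteq> \<infinity>"
      using step IH(2) by auto
    moreover have "V 0 x0 = ereal (\<Sum>k<Suc n. c k (T k) (u k)) + V (Suc n) (T (Suc n))"
      using IH(3) step by (simp add: add.assoc flip: plus_ereal.simps(1))
    ultimately show ?case
      by blast
  qed
  have "is_path N U F x0 u T"
    unfolding is_path_def
  proof (intro conjI allI impI)
    fix k assume "k < N"
    then show "u k \<in> U k (T k)"
      using inv[of k] \<mu>(1) by (simp add: u_def)
  qed (simp_all add: T_0 T_Suc)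
  moreover have "V 0 x0 = ereal ((\<Sum>k<N. c k (T k) (u k)) + h (T N))"
    using inv[of N] terminal by simp
  ultimately show ?thesis
    by blast
qed

theorem principle_of_optimality:
  assumes "x0 \<in> X"
  shows "is_minimum {ereal ((\<Sum>k<N. c k (T k) (u k)) + h (T N)) | u T. is_path N U F x0 u T}
    (V 0 x0)"
  using cost_to_go_le[OF _ assms] cost_to_go_attained[OF assms]
  by (auto simp: is_minimum_iff)

end

section \<open>The thermostat as a multistage problem\<close>

lemma dynamics_in_carrier: "dynamics P x u \<in> carrier_vec (num_nodes P)"
  by (rule carrier_vecI) (simp add: dynamics_def B_vec_def)

lemma S_on_Un_S_off: "S_on P \<union> S_off P = {..<num_steps P}"
  by (auto simp: S_on_def S_off_def)

lemma energy_cost_eq_sum_stage_costs: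
  "energy_cost P u T1 p_on p_off =
     (\<Sum>k<num_steps P. dilated_price P p_on p_off k * power_consumption P k (u $ k) (T1 k) * time_step P)"
proof -
  let ?c = "\<lambda>k. dilated_price P p_on p_off k * power_consumption P k (u $ k) (T1 k) * time_step P"
  have "(\<Sum>k<num_steps P. ?c k) = sum ?c (S_off P) + sum ?c (S_on P)"
    unfolding S_off_def by (rule sum.subset_diff) (auto simp: S_on_def)
  moreover have "sum ?c (S_off P) =
      (\<Sum>k\<in>S_off P. p_off * power_consumption P k (u $ k) (T1 k) * time_step P)"
    by (rule sum.cong) (auto simp: dilated_price_def)
  moreover have "sum ?c (S_on P) =
      (\<Sum>k\<in>S_on P. p_on * power_consumption P k (u $ k) (T1 k) * time_step P)"
    by (rule sum.cong) (auto simp: dilated_price_def S_off_def)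
  ultimately show ?thesis
    by (simp add: energy_cost_def sum_distrib_left sum_distrib_right distrib_right)
qed

text \<open>Paths do not mention the dimension of the states; it comes from the initial state and is kept by
  the dynamics.\<close>

lemma feasible_iff_is_path:
  assumes "u \<in> carrier_vec (num_steps P)"
  shows "(u, T) \<in> feasible P \<gamma> \<longleftrightarrow>
    is_path (num_steps P) (allowable_inputs P \<gamma>) (dynamics P) (initial_state P) (\<lambda>k. u $ k) T"
    (is "_ \<longleftrightarrow> ?path")
proof
  assume "(u, T) \<in> feasible P \<gamma>"
  then show ?path
    by (simp add: feasible_def is_path_def allowable_inputs_def S_on_Un_S_off)
next
  assume path: ?path
  have carrier: "T k \<in> carrier_vec (num_nodes P)" if "k \<le> num_steps P" for k
    using that path
    by (cases k) (auto simp: is_path_def initial_state_def dynamics_in_carrier)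
  have u: "u $ k \<in> allowable_inputs P \<gamma> k (T k)"
      and T: "T (Suc k) = dynamics P (T k) (u $ k)" if "k < num_steps P" for k
    using path that by (simp_all add: is_path_def)
  have peak: "power_consumption P k (u $ k) (T k $ 0) \<le> \<gamma>" if "k \<in> S_on P" for k
    using u[of k] that by (simp add: allowable_inputs_def S_on_def)
  have bounds: "temp_min P \<le> u $ k \<and> u $ k \<le> temp_max P" if "k < num_steps P" for k
    using u[OF that] by (simp add: allowable_inputs_def split: if_splits)
  have "T 0 = initial_state P"
    using path by (simp add: is_path_def)
  then show "(u, T) \<in> feasible P \<gamma>"
    by (simp add: feasible_def S_on_Un_S_off assms carrier T peak bounds)
qed

text \<open>Input vectors of length \<open>N\<close> and input functions are exchanged here; restricting a function to
  the first \<open>N\<close> stages changes neither the path property nor the cost.\<close>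

lemma total_costs_eq_path_costs:
  "total_costs P \<gamma> p_on p_off p_d =
     {ereal ((\<Sum>k<num_steps P. dilated_price P p_on p_off k
                * power_consumption P k (u k) (T k $ 0) * time_step P) + p_d / 30 * \<gamma>) | u T.
        is_path (num_steps P) (allowable_inputs P \<gamma>) (dynamics P) (initial_state P) u T}"
  (is "_ = {ereal (?cost u T) | u T. ?path u T}")
proof (intro equalityI subsetI)
  fix s assume "s \<in> total_costs P \<gamma> p_on p_off p_d"
  then obtain u T where feas: "(u, T) \<in> feasible P \<gamma>"
      and s: "s = ereal (energy_cost P u (\<lambda>k. T k $ 0) p_on p_off + p_d / 30 * \<gamma>)"
    by (auto simp: total_costs_def)
  have "u \<in> carrier_vec (num_steps P)"
    using feas by (simp add: feasible_def)
  with feas have "?path (\<lambda>k. u $ k) T"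
    by (simp add: feasible_iff_is_path)
  moreover have "s = ereal (?cost (\<lambda>k. u $ k) T)"
    by (simp add: s energy_cost_eq_sum_stage_costs)
  ultimately show "s \<in> {ereal (?cost u T) | u T. ?path u T}"
    by blast
next
  fix s assume "s \<in> {ereal (?cost u T) | u T. ?path u T}"
  then obtain u T where path: "?path u T" and s: "s = ereal (?cost u T)"
    by blast
  have "?path (\<lambda>k. vec (num_steps P) u $ k) T"
    using path by (simp add: is_path_def)
  then have "(vec (num_steps P) u, T) \<in> feasible P \<gamma>"
    by (simp add: feasible_iff_is_path)
  moreover have "s = ereal (energy_cost P (vec (num_steps P) u) (\<lambda>k. T k $ 0) p_on p_off + p_d / 30 * \<gamma>)"
    by (simp add: s energy_cost_eq_sum_stage_costs)
  ultimately show "s \<in> total_costs P \<gamma> p_on p_off p_d"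
    unfolding total_costs_def by blast
qed

theorem theorem21:
  fixes P :: thermostat and p_on p_off p_d \<gamma> :: real and V :: "nat \<Rightarrow> real vec \<Rightarrow> ereal"
  assumes "num_steps P > 0" and "num_nodes P > 0"
    and "time_step P > 0" and "real (num_steps P) * time_step P = 24"
    and "0 \<le> on_peak_start P" and "on_peak_start P < on_peak_end P" and "on_peak_end P \<le> 24"
    and "\<gamma> \<ge> 0"
    and "\<And>x. x \<in> carrier_vec (num_nodes P) \<Longrightarrow> V (num_steps P) x = ereal (p_d / 30 * \<gamma>)"
    and "\<And>j x. 1 \<le> j \<Longrightarrow> j \<le> num_steps P \<Longrightarrow> x \<in> carrier_vec (num_nodes P) \<Longrightarrow>
      is_minimum
        {ereal (dilated_price P p_on p_off (j - 1) * power_consumption P (j - 1) u (x $ 0) * time_step P)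
           + V j (dynamics P x u) | u. u \<in> allowable_inputs P \<gamma> (j - 1) x}
        (V (j - 1) x)"
  shows "V 0 (initial_state P) = J_star P \<gamma> p_on p_off p_d
    \<and> is_minimum (total_costs P \<gamma> p_on p_off p_d) (J_star P \<gamma> p_on p_off p_d)"
proof -
  interpret bellman_recursion "num_steps P" "carrier_vec (num_nodes P)" "allowable_inputs P \<gamma>"
    "dynamics P"
    "\<lambda>k x u. dilated_price P p_on p_off k * power_consumption P k u (x $ 0) * time_step P"
    "\<lambda>_. p_d / 30 * \<gamma>" V
  proof
    show "dynamics P x u \<in> carrier_vec (num_nodes P)" for x u
      by (rule dynamics_in_carrier)
    show "V (num_steps P) x = ereal (p_d / 30 * \<gamma>)" if "x \<in> carrier_vec (num_nodes P)" for x
      using that by (rule assms(9))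
    show "is_minimum
        {ereal (dilated_price P p_on p_off k * power_consumption P k u (x $ 0) * time_step P)
           + V (Suc k) (dynamics P x u) | u. u \<in> allowable_inputs P \<gamma> k x} (V k x)"
      if "k < num_steps P" and "x \<in> carrier_vec (num_nodes P)" for k x
      using assms(10)[of "Suc k" x] that by simp
  qed
  have "initial_state P \<in> carrier_vec (num_nodes P)"
    by (simp add: initial_state_def)
  then have min: "is_minimum (total_costs P \<gamma> p_on p_off p_d) (V 0 (initial_state P))"
    unfolding total_costs_eq_path_costs by (rule principle_of_optimality)
  then have "V 0 (initial_state P) = J_star P \<gamma> p_on p_off p_d"
    unfolding is_minimum_def J_star_def by (rule conjunct1)
  with min show ?thesis
    by simp
qed

end
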